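(* Let $\{\lambda_n\}_{n=1}^{N}$ and $\{\mu_n\}_{n=1}^{N}$ be nonnegative and nonincreasing sequences of real numbers with $\{\lambda_n\}_{n=1}^{N}\succeq\{\mu_n\}_{n=1}^{N}$. Every corresponding sequence of inner eigensteps $\{\{\lambda_{n;m}\}_{m=1}^{n}\}_{n=1}^{N}$ can be constructed by the following algorithm: Let $\lambda_{N;m}=\lambda_m$ for all $m=1,\dots,N$; for $n=N,N-1,\dots,2$ (in this order), construct $\{\lambda_{n-1;m}\}_{m=1}^{n-1}$ from $\{\lambda_{n;m}\}_{m=1}^{n}$ by picking $\lambda_{n-1;k}\in[A_{n-1;k},B_{n-1;k}]$ for all $k=n-1,n-2,\dots,1$ (in this order), where $$A_{n-1;k}:=\max \bigg\{ \lambda_{n;k+1},\ \sum_{m=k}^{n} \lambda_{n;m} - \sum_{m=k+1}^{n-1} \lambda_{n-1;m} - \mu_n \bigg\},$$ $$B_{n-1;k}:=\min \bigg\{ \lambda_{n;k},\ \min_{l=1,\dots,k} \bigg\{\sum_{m=l}^{n-1} \mu_m - \sum_{m=l+1}^{k} \lambda_{n;m} - \sum_{m=k+1}^{n-1} \lambda_{n-1;m} \bigg\}\bigg\},$$ and sums over empty sets of indices are zero. Moreover, any sequence constructed by this algorithm is indeed a corresponding sequence of inner eigensteps.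
   Context: Majorization: for nonincreasing real sequences $\{\lambda_n\}_{n=1}^N$ and $\{\mu_n\}_{n=1}^N$, one writes $\{\lambda_n\}_{n=1}^N\succeq\{\mu_n\}_{n=1}^N$ if $\sum_{m=1}^n\lambda_m\geq\sum_{m=1}^n\mu_m$ for all $n=1,\dots,N-1$ and $\sum_{m=1}^N\lambda_m=\sum_{m=1}^N\mu_m$. Interlacing: one writes $\{\alpha_m\}_{m=1}^{n-1}\sqsubseteq\{\beta_m\}_{m=1}^{n}$ if $\beta_{m+1}\leq\alpha_m\leq\beta_m$ for all $m=1,\ldots,n-1$. Inner eigensteps: let $\{\lambda_n\}_{n=1}^{N}$ and $\{\mu_n\}_{n=1}^{N}$ be nonnegative nonincreasing sequences. A corresponding sequence of inner eigensteps is a sequence of sequences $\{\{\lambda_{n;m}\}_{m=1}^{n}\}_{n=1}^{N}$ satisfying: (i) $\lambda_{N;m}=\lambda_m$ for every $m=1,\ldots,N$; (ii) $\{\lambda_{n-1;m}\}_{m=1}^{n-1}\sqsubseteq\{\lambda_{n;m}\}_{m=1}^{n}$ for every $n=2,\dots,N$; (iii) $\sum_{m=1}^{n}\lambda_{n;m}=\sum_{m=1}^{n}\mu_{m}$ for every $n=1,\dots,N$. *)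

theory Defs
  imports Complex_Main
begin

text \<open>
  A sequence $\{x_m\}_{m=1}^N$ is a function on \<open>nat\<close> of which only the values on \<open>{1..N}\<close>
  matter. A triangular array $\{\{\lambda_{n;m}\}_{m=1}^n\}_{n=1}^N$ is a function \<open>E\<close> with
  \<open>E n m\<close> for $\lambda_{n;m}$, of which only the values with \<open>1 \<le> m \<le> n \<le> N\<close> matter.
\<close>

definition majorizes :: "nat \<Rightarrow> (nat \<Rightarrow> real) \<Rightarrow> (nat \<Rightarrow> real) \<Rightarrow> bool" where
  "majorizes N lam mu \<longleftrightarrow>
     (\<forall>n\<in>{1..N-1}. (\<Sum>m=1..n. lam m) \<ge> (\<Sum>m=1..n. mu m)) \<and>
     (\<Sum>m=1..N. lam m) = (\<Sum>m=1..N. mu m)"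

text \<open>\<open>n\<close> is the length of the longer sequence \<open>b\<close>.\<close>

definition interlaces :: "nat \<Rightarrow> (nat \<Rightarrow> real) \<Rightarrow> (nat \<Rightarrow> real) \<Rightarrow> bool" where
  "interlaces n a b \<longleftrightarrow> (\<forall>m\<in>{1..n-1}. b (m + 1) \<le> a m \<and> a m \<le> b m)"

definition inner_eigensteps ::
  "nat \<Rightarrow> (nat \<Rightarrow> real) \<Rightarrow> (nat \<Rightarrow> real) \<Rightarrow> (nat \<Rightarrow> nat \<Rightarrow> real) \<Rightarrow> bool" where
  "inner_eigensteps N lam mu E \<longleftrightarrow>
     (\<forall>m\<in>{1..N}. E N m = lam m) \<and>
     (\<forall>n\<in>{2..N}. interlaces n (E (n-1)) (E n)) \<and>
     (\<forall>n\<in>{1..N}. (\<Sum>m=1..n. E n m) = (\<Sum>m=1..n. mu m))"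

text \<open>
  \<open>lower_end mu E n k\<close> and \<open>upper_end mu E n k\<close> are $A_{n-1;k}$ and $B_{n-1;k}$
  (for \<open>n \<ge> 2\<close> and \<open>1 \<le> k \<le> n - 1\<close>).
\<close>

definition lower_end :: "(nat \<Rightarrow> real) \<Rightarrow> (nat \<Rightarrow> nat \<Rightarrow> real) \<Rightarrow> nat \<Rightarrow> nat \<Rightarrow> real" where
  "lower_end mu E n k =
     max (E n (k + 1))
         ((\<Sum>m=k..n. E n m) - (\<Sum>m=k+1..n-1. E (n-1) m) - mu n)"

definition upper_end :: "(nat \<Rightarrow> real) \<Rightarrow> (nat \<Rightarrow> nat \<Rightarrow> real) \<Rightarrow> nat \<Rightarrow> nat \<Rightarrow> real" where
  "upper_end mu E n k =
     min (E n k)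
         (MIN l\<in>{1..k}. (\<Sum>m=l..n-1. mu m) - (\<Sum>m=l+1..k. E n m) - (\<Sum>m=k+1..n-1. E (n-1) m))"

text \<open>
  \<open>alg_state N lam mu n k E\<close>: the algorithm can be in a state in which it has constructed the
  rows \<open>N, \<dots>, n\<close> of \<open>E\<close> and, in row \<open>n - 1\<close>, has picked the entries \<open>n - 1, \<dots>, k\<close>
  (none if \<open>k = n\<close>). Entries not yet constructed are arbitrary. The final states are those with
  \<open>n = k = 1\<close>.
\<close>

inductive alg_state ::
  "nat \<Rightarrow> (nat \<Rightarrow> real) \<Rightarrow> (nat \<Rightarrow> real) \<Rightarrow> nat \<Rightarrow> nat \<Rightarrow> (nat \<Rightarrow> nat \<Rightarrow> real) \<Rightarrow> bool"
  for N :: nat and lam mu :: "nat \<Rightarrow> real" where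
  init: "(\<forall>m\<in>{1..N}. E N m = lam m) \<Longrightarrow> alg_state N lam mu N N E"
| pick: "alg_state N lam mu n (k + 1) E \<Longrightarrow> 2 \<le> n \<Longrightarrow> 1 \<le> k \<Longrightarrow>
    x \<in> {lower_end mu E n k..upper_end mu E n k} \<Longrightarrow>
    alg_state N lam mu n k (E(n-1 := (E (n-1))(k := x)))"
| next_row: "alg_state N lam mu n 1 E \<Longrightarrow> 2 \<le> n \<Longrightarrow> alg_state N lam mu (n-1) (n-1) E"

definition constructed_by_algorithm ::
  "nat \<Rightarrow> (nat \<Rightarrow> real) \<Rightarrow> (nat \<Rightarrow> real) \<Rightarrow> (nat \<Rightarrow> nat \<Rightarrow> real) \<Rightarrow> bool" where
  "constructed_by_algorithm N lam mu E \<longleftrightarrow> alg_state N lam mu 1 1 E"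

text \<open>Whenever an entry is to be picked, the interval to pick it from is nonempty.\<close>

definition algorithm_never_stuck :: "nat \<Rightarrow> (nat \<Rightarrow> real) \<Rightarrow> (nat \<Rightarrow> real) \<Rightarrow> bool" where
  "algorithm_never_stuck N lam mu \<longleftrightarrow>
     (\<forall>n k E. 2 \<le> n \<longrightarrow> 1 \<le> k \<longrightarrow> alg_state N lam mu n (k + 1) E \<longrightarrow>
        {lower_end mu E n k..upper_end mu E n k} \<noteq> {})"

end

theory Submission
  imports Defs
begin

text \<open>
  Write \<open>b\<close> for a finished row of length \<open>p + 1\<close> and \<open>a\<close> for the row of length \<open>p\<close> that is being
  filled from right to left. The bounds \<open>\<lambda>\<^sub>n\<^sub>;\<^sub>k\<^sub>+\<^sub>1 \<le> x \<le> \<lambda>\<^sub>n\<^sub>;\<^sub>k\<close> on a pick \<open>x\<close> are interlacing. After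
  moving the entries already picked to the side of \<open>x\<close>, the other bounds constrain only the tail
  sum of \<open>a\<close> from position \<open>k\<close> on: it lies above \<open>(\<Sum>m=k..p+1. b m) - mu (p+1)\<close> and, for every
  \<open>l \<le> k\<close>, below \<open>(\<Sum>m=l..p. mu m) - (\<Sum>m=l+1..k. b m)\<close>. This is \<open>tail_bounds\<close>.

  For an array of eigensteps these bounds are necessary. Row sums differ by \<open>mu (p+1)\<close>, so the
  lower bound says that the first \<open>k - 1\<close> entries of \<open>a\<close> sum to at most those of \<open>b\<close>, which is
  interlacing. For the upper bound, interlacing gives \<open>b (m+1) \<le> a m\<close>, so the left side of
  \<open>(\<Sum>m=l+1..k. b m) + (\<Sum>m=k..p. a m) \<le> (\<Sum>m=l..p. mu m)\<close> is at most \<open>\<Sum>m=l..p. a m\<close>, and every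
  row of an array of eigensteps majorizes the corresponding initial part of \<open>mu\<close>
  (\<open>eigensteps_tail_bounds\<close>).

  Conversely, once the whole row is filled, the upper bounds with \<open>l = k\<close> say that \<open>a\<close> majorizes
  \<open>mu\<close> up to position \<open>p\<close>, and the lower bound at \<open>k = 1\<close> turns the one for \<open>l = k = 1\<close> into an
  equality of total sums (\<open>majorizing_row_next\<close>). Hence the next row starts from the same situation.

  The algorithm does not get stuck because the interval at position \<open>k\<close> is nonempty as soon as the
  tail bounds hold at \<open>k + 1\<close> (\<open>lower_end_le_upper_end\<close>): comparing interlacing bounds with sum
  bounds yields exactly the tail bounds at \<open>k + 1\<close>, and the two sum bounds are compatible because
  \<open>b\<close> is nonincreasing and majorizes \<open>mu\<close>. Before the first pick, the tail of \<open>a\<close> is empty and the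
  tail bounds at \<open>p + 1\<close> follow from majorization and from \<open>mu\<close> being nonincreasing
  (\<open>tail_bounds_start\<close>).
\<close>

section \<open>Majorizing rows and tail bounds\<close>

text \<open>
  Majorization is expressed by tail sums because rows are filled from the right; given equal
  totals, this is equivalent to the usual comparison of initial sums.
\<close>

definition majorizing_row :: "(nat \<Rightarrow> real) \<Rightarrow> nat \<Rightarrow> (nat \<Rightarrow> real) \<Rightarrow> bool" where
  "majorizing_row mu n b \<longleftrightarrow>
     antimono_on {1..n} b \<and> (\<Sum>m=1..n. b m) = (\<Sum>m=1..n. mu m) \<and>
     (\<forall>l\<in>{1..n}. (\<Sum>m=l..n. b m) \<le> (\<Sum>m=l..n. mu m))"

text \<open>
  The formula is meaningful for \<open>1 \<le> k \<le> p + 1\<close>. Including \<open>k = p + 1\<close>, where the tail of \<open>a\<close> is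
  empty, gives a starting point for the induction along a row.
\<close>

definition tail_bounds ::
  "(nat \<Rightarrow> real) \<Rightarrow> nat \<Rightarrow> (nat \<Rightarrow> real) \<Rightarrow> (nat \<Rightarrow> real) \<Rightarrow> nat \<Rightarrow> bool" where
  "tail_bounds mu p b a k \<longleftrightarrow>
     (\<Sum>m=k..Suc p. b m) \<le> mu (Suc p) + (\<Sum>m=k..p. a m) \<and>
     (\<forall>l\<in>{1..k}. (\<Sum>m=Suc l..k. b m) + (\<Sum>m=k..p. a m) \<le> (\<Sum>m=l..p. mu m))"

lemma sum_split_interval:
  fixes f :: "nat \<Rightarrow> real"
  assumes "l \<le> Suc k" "k \<le> n"
  shows "sum f {l..n} = sum f {l..k} + sum f {Suc k..n}"
  using assms sum.ub_add_nat[of l k f "n - k"] by simp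

lemma tail_bounds_upper:
  assumes "tail_bounds mu p b a k" "1 \<le> l" "l \<le> k"
  shows "(\<Sum>m=Suc l..k. b m) + (\<Sum>m=k..p. a m) \<le> (\<Sum>m=l..p. mu m)"
  using assms by (simp add: tail_bounds_def)

lemma tail_bounds_cong:
  assumes "\<And>m. k \<le> m \<Longrightarrow> m \<le> p \<Longrightarrow> a m = a' m"
  shows "tail_bounds mu p b a k \<longleftrightarrow> tail_bounds mu p b a' k"
proof -
  have "(\<Sum>m=k..p. a m) = (\<Sum>m=k..p. a' m)"
    by (rule sum.cong) (use assms in auto)
  then show ?thesis
    by (simp add: tail_bounds_def)
qed

lemma mem_pick_interval_iff:
  assumes "1 \<le> k" "k \<le> p"
  shows "x \<in> {lower_end mu E (Suc p) k..upper_end mu E (Suc p) k} \<longleftrightarrow>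
    E (Suc p) (Suc k) \<le> x \<and> x \<le> E (Suc p) k \<and> tail_bounds mu p (E (Suc p)) ((E p)(k := x)) k"
proof -
  have tail: "(\<Sum>m=k..p. ((E p)(k := x)) m) = x + (\<Sum>m=Suc k..p. E p m)"
    using assms by (simp add: sum.atLeast_Suc_atMost)
  let ?u = "\<lambda>l. (\<Sum>m=l..p. mu m) - (\<Sum>m=Suc l..k. E (Suc p) m) - (\<Sum>m=Suc k..p. E p m)"
  have "x \<le> (MIN l\<in>{1..k}. ?u l) \<longleftrightarrow> (\<forall>l\<in>{1..k}. x \<le> ?u l)"
    using assms by (subst Min_ge_iff) auto
  also have "\<dots> \<longleftrightarrow> (\<forall>l\<in>{1..k}. (\<Sum>m=Suc l..k. E (Suc p) m) +
      (x + (\<Sum>m=Suc k..p. E p m)) \<le> (\<Sum>m=l..p. mu m))"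
    by (intro ball_cong) auto
  finally have upper: "x \<le> upper_end mu E (Suc p) k \<longleftrightarrow> x \<le> E (Suc p) k \<and>
      (\<forall>l\<in>{1..k}. (\<Sum>m=Suc l..k. E (Suc p) m) + (x + (\<Sum>m=Suc k..p. E p m)) \<le> (\<Sum>m=l..p. mu m))"
    unfolding upper_end_def by simp
  have "lower_end mu E (Suc p) k \<le> x \<longleftrightarrow> E (Suc p) (Suc k) \<le> x \<and>
      (\<Sum>m=k..Suc p. E (Suc p) m) \<le> mu (Suc p) + (x + (\<Sum>m=Suc k..p. E p m))"
    unfolding lower_end_def by (simp del: sum.cl_ivl_Suc add: algebra_simps)
  then show ?thesis
    unfolding tail_bounds_def tail atLeastAtMost_iff[of x] upper by blast
qed

section \<open>One row of the algorithm\<close>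

text \<open>
  For the upper bounds, replacing the tail of \<open>mu\<close> from \<open>l + 1\<close> to \<open>p + 1\<close> by the one from \<open>l\<close> to
  \<open>p\<close> exchanges \<open>mu (p+1)\<close> for \<open>mu l\<close>, which is at least as large since \<open>mu\<close> is nonincreasing.
\<close>

lemma tail_bounds_start:
  assumes b: "majorizing_row mu (Suc p) b" and mu: "antimono_on {1..Suc p} mu"
  shows "tail_bounds mu p b a (Suc p)"
proof -
  have tail: "(\<Sum>m=l..Suc p. b m) \<le> (\<Sum>m=l..Suc p. mu m)" if "1 \<le> l" "l \<le> Suc p" for l
    using b that by (auto simp: majorizing_row_def)
  have "(\<Sum>m=Suc l..Suc p. b m) \<le> (\<Sum>m=l..p. mu m)" if l: "1 \<le> l" "l \<le> Suc p" for l
  proof (cases "l = Suc p")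
    case False
    then have "l \<le> p" using l by simp
    have "(\<Sum>m=Suc l..Suc p. b m) \<le> (\<Sum>m=Suc l..Suc p. mu m)"
      using \<open>l \<le> p\<close> by (intro tail) auto
    also have "\<dots> = (\<Sum>m=l..p. mu m) + mu (Suc p) - mu l"
      using \<open>l \<le> p\<close> sum.atLeast_Suc_atMost[of l p mu] by simp
    also have "mu (Suc p) \<le> mu l"
      using mu l by (auto simp: monotone_on_def)
    finally show ?thesis by simp
  qed simp
  then show ?thesis
    using tail[of "Suc p"] by (auto simp: tail_bounds_def)
qed

text \<open>
  Two lower and two upper bounds give four inequalities. The entry \<open>b k\<close> against the lower sum bound
  and \<open>b (k+1)\<close> against the upper ones are the tail bounds at \<open>k + 1\<close>. The sum bounds against each
  other reduce to \<open>b k + (\<Sum>m=l+1..p+1. b m) \<le> (\<Sum>m=l..p+1. mu m)\<close>, which follows from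
  majorization after replacing \<open>b k\<close> by \<open>b l\<close>; the tail of \<open>a\<close> cancels.
\<close>

lemma lower_end_le_upper_end:
  assumes k: "1 \<le> k" "k \<le> p"
    and b: "majorizing_row mu (Suc p) (E (Suc p))"
    and tb: "tail_bounds mu p (E (Suc p)) (E p) (Suc k)"
  shows "lower_end mu E (Suc p) k \<le> upper_end mu E (Suc p) k"
proof -
  let ?b = "E (Suc p)" and ?S = "\<Sum>m=Suc k..p. E p m"
  let ?low = "(\<Sum>m=k..Suc p. ?b m) - ?S - mu (Suc p)"
  let ?up = "\<lambda>l. (\<Sum>m=l..p. mu m) - (\<Sum>m=Suc l..k. ?b m) - ?S"
  have anti: "?b j \<le> ?b i" if "1 \<le> i" "i \<le> j" "j \<le> Suc p" for i j
    using b that by (auto simp: majorizing_row_def monotone_on_def)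
  have low_tail: "(\<Sum>m=Suc k..Suc p. ?b m) \<le> mu (Suc p) + ?S"
    using tb by (simp add: tail_bounds_def)
  have head: "(\<Sum>m=k..Suc p. ?b m) = ?b k + (\<Sum>m=Suc k..Suc p. ?b m)"
    using k by (intro sum.atLeast_Suc_atMost) simp
  have "?b (Suc k) \<le> ?b k"
    using k by (intro anti) auto
  moreover have "?low \<le> ?b k"
    using low_tail head by simp
  moreover have "?b (Suc k) \<le> ?up l" if "l \<in> {1..k}" for l
  proof -
    have "(\<Sum>m=Suc l..Suc k. ?b m) + ?S \<le> (\<Sum>m=l..p. mu m)"
      using that by (intro tail_bounds_upper[OF tb]) auto
    then show ?thesis
      using that by simp
  qed
  moreover have "?low \<le> ?up l" if l: "l \<in> {1..k}" for l
  proof -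
    have "(\<Sum>m=Suc l..k. ?b m) + (\<Sum>m=Suc k..Suc p. ?b m) = (\<Sum>m=Suc l..Suc p. ?b m)"
      using l k by (intro sum_split_interval[symmetric]) auto
    moreover have "?b l + (\<Sum>m=Suc l..Suc p. ?b m) = (\<Sum>m=l..Suc p. ?b m)"
      using l k by (intro sum.atLeast_Suc_atMost[symmetric]) auto
    moreover have "(\<Sum>m=l..Suc p. ?b m) \<le> (\<Sum>m=l..Suc p. mu m)"
      using b l k by (auto simp: majorizing_row_def)
    moreover have "(\<Sum>m=l..Suc p. mu m) = (\<Sum>m=l..p. mu m) + mu (Suc p)"
      using l k by simp
    moreover have "?b k \<le> ?b l"
      using l k by (intro anti) auto
    ultimately show ?thesis
      using head by linarith
  qed
  ultimately show ?thesis
    using k by (simp add: lower_end_def upper_end_def)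
qed

lemma majorizing_row_next:
  assumes "1 \<le> p" and b: "majorizing_row mu (Suc p) b"
    and int: "interlaces (Suc p) a b"
    and tb: "\<And>k. 1 \<le> k \<Longrightarrow> k \<le> p \<Longrightarrow> tail_bounds mu p b a k"
  shows "majorizing_row mu p a"
proof -
  have int': "b (Suc m) \<le> a m \<and> a m \<le> b m" if "1 \<le> m" "m \<le> p" for m
    using int that by (auto simp: interlaces_def)
  have tail: "(\<Sum>m=l..p. a m) \<le> (\<Sum>m=l..p. mu m)" if "1 \<le> l" "l \<le> p" for l
    using tail_bounds_upper[OF tb[OF that], of l] that by simp
  have "(\<Sum>m=1..Suc p. b m) \<le> mu (Suc p) + (\<Sum>m=1..p. a m)"
    using tb[of 1] \<open>1 \<le> p\<close> unfolding tail_bounds_def by simp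
  then have "(\<Sum>m=1..p. mu m) \<le> (\<Sum>m=1..p. a m)"
    using b by (simp add: majorizing_row_def)
  with tail[of 1] \<open>1 \<le> p\<close> have "(\<Sum>m=1..p. a m) = (\<Sum>m=1..p. mu m)"
    by simp
  moreover have "a j \<le> a i" if "1 \<le> i" "i \<le> j" "j \<le> p" for i j
  proof (cases "i = j")
    case False
    have "a j \<le> b j" using int' that by simp
    also have "\<dots> \<le> b (Suc i)"
      using b that False by (auto simp: majorizing_row_def monotone_on_def)
    also have "\<dots> \<le> a i" using int' that by simp
    finally show ?thesis .
  qed simp
  ultimately show ?thesis
    using tail by (auto simp: majorizing_row_def monotone_on_def)
qed

section \<open>Every run produces eigensteps and never gets stuck\<close>

text \<open>
  Together with the state of the row under construction, the invariant keeps that every finished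
  row majorizes \<open>mu\<close>: row \<open>n\<close> needs it for the remaining picks, and the equality of total sums in
  it is the sum condition on eigensteps. The last conjunct includes \<open>j = n\<close>, which is the position
  before the first pick.
\<close>

definition alg_invariant ::
  "nat \<Rightarrow> (nat \<Rightarrow> real) \<Rightarrow> (nat \<Rightarrow> real) \<Rightarrow> nat \<Rightarrow> nat \<Rightarrow> (nat \<Rightarrow> nat \<Rightarrow> real) \<Rightarrow> bool" where
  "alg_invariant N lam mu n k E \<longleftrightarrow>
     1 \<le> k \<and> k \<le> n \<and> n \<le> N \<and>
     (\<forall>m\<in>{1..N}. E N m = lam m) \<and>
     (\<forall>j\<in>{Suc n..N}. interlaces j (E (j - 1)) (E j)) \<and>
     (\<forall>j\<in>{n..N}. majorizing_row mu j (E j)) \<and>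
     (\<forall>j\<in>{k..n-1}. E n (Suc j) \<le> E (n-1) j \<and> E (n-1) j \<le> E n j) \<and>
     (\<forall>j\<in>{k..n}. tail_bounds mu (n-1) (E n) (E (n-1)) j)"

lemma majorizing_row_init:
  assumes "antimono_on {1..N} lam" and maj: "majorizes N lam mu"
    and row: "\<forall>m\<in>{1..N}. b m = lam m"
  shows "majorizing_row mu N b"
proof -
  have b_sum: "(\<Sum>m=l..n. b m) = (\<Sum>m=l..n. lam m)" if "1 \<le> l" "n \<le> N" for l n
    using that row by (intro sum.cong) auto
  have total: "(\<Sum>m=1..N. lam m) = (\<Sum>m=1..N. mu m)"
    using maj by (simp add: majorizes_def)
  have "(\<Sum>m=l..N. lam m) \<le> (\<Sum>m=l..N. mu m)" if l: "1 \<le> l" "l \<le> N" for l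
  proof -
    have "(\<Sum>m=1..l-1. mu m) \<le> (\<Sum>m=1..l-1. lam m)"
    proof (cases "l = 1")
      case False
      then have "l - 1 \<in> {1..N-1}" using l by auto
      then show ?thesis using maj by (simp add: majorizes_def)
    qed simp
    moreover have split: "sum f {1..N} = sum f {1..l-1} + sum f {l..N}"
      for f :: "nat \<Rightarrow> real"
      using sum_split_interval[of 1 "l-1" N f] l by simp
    ultimately show ?thesis
      using total split[of lam] split[of mu] by linarith
  qed
  then show ?thesis
    using assms(1) row b_sum total by (auto simp: majorizing_row_def monotone_on_def)
qed

lemma alg_state_invariant:
  assumes "1 \<le> N" and lam: "antimono_on {1..N} lam" and mu: "antimono_on {1..N} mu"
    and maj: "majorizes N lam mu"
    and "alg_state N lam mu n k E"
  shows "alg_invariant N lam mu n k E"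
proof -
  have start: "tail_bounds mu (n-1) b a n"
    if "1 \<le> n" "n \<le> N" "majorizing_row mu n b" for n a b
  proof -
    have "antimono_on {1..Suc (n-1)} mu"
      using mu that by (auto simp: monotone_on_def)
    then show ?thesis
      using tail_bounds_start[of mu "n-1" b a] that by simp
  qed
  show ?thesis
    using assms(5)
  proof (induction rule: alg_state.induct)
    case (init E)
    then have "majorizing_row mu N (E N)"
      by (rule majorizing_row_init[OF lam maj])
    with init start[of N] \<open>1 \<le> N\<close> show ?case
      by (auto simp: alg_invariant_def)
  next
    case (pick n k E x)
    then obtain p where n: "n = Suc p" by (cases n) auto
    have inv: "alg_invariant N lam mu (Suc p) (Suc k) E"
      using pick.IH n by simp
    then have "k \<le> p" by (simp add: alg_invariant_def)
    let ?E = "E(p := (E p)(k := x))"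
    have x: "E (Suc p) (Suc k) \<le> x" "x \<le> E (Suc p) k"
      "tail_bounds mu p (E (Suc p)) ((E p)(k := x)) k"
      using pick.hyps(4) mem_pick_interval_iff[OF \<open>1 \<le> k\<close> \<open>k \<le> p\<close>] n by blast+
    have upper_rows: "?E j = E j" if "Suc p \<le> j" for j
      using that by auto
    have "\<forall>j\<in>{Suc (Suc p)..N}. interlaces j (?E (j - 1)) (?E j)"
    proof
      fix j assume "j \<in> {Suc (Suc p)..N}"
      then have "Suc p \<le> j - 1" "Suc p \<le> j" "interlaces j (E (j - 1)) (E j)"
        using inv by (auto simp: alg_invariant_def)
      then show "interlaces j (?E (j - 1)) (?E j)"
        using upper_rows by metis
    qed
    moreover have "tail_bounds mu p (?E (Suc p)) (?E p) j" if "j \<in> {k..Suc p}" for j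
    proof (cases "j = k")
      case False
      then have "tail_bounds mu p (E (Suc p)) (E p) j"
        using inv that by (auto simp: alg_invariant_def)
      moreover have "tail_bounds mu p (E (Suc p)) (E p) j \<longleftrightarrow>
          tail_bounds mu p (E (Suc p)) ((E p)(k := x)) j"
        by (rule tail_bounds_cong) (use that False in auto)
      ultimately show ?thesis
        by simp
    qed (use x in simp)
    moreover have "\<forall>j\<in>{k..p}. ?E (Suc p) (Suc j) \<le> ?E p j \<and> ?E p j \<le> ?E (Suc p) j"
      using inv x by (auto simp: alg_invariant_def)
    moreover have "\<forall>j\<in>{Suc p..N}. majorizing_row mu j (?E j)"
      using inv upper_rows by (auto simp: alg_invariant_def)
    moreover have "\<forall>m\<in>{1..N}. ?E N m = lam m" "Suc p \<le> N"
      using inv by (auto simp: alg_invariant_def)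
    ultimately show ?case
      using \<open>1 \<le> k\<close> \<open>k \<le> p\<close> n unfolding alg_invariant_def by simp
  next
    case (next_row n E)
    then obtain p where n: "n = Suc p" "1 \<le> p" by (cases n) auto
    have inv: "alg_invariant N lam mu (Suc p) 1 E"
      using next_row.IH n by simp
    have int: "interlaces (Suc p) (E p) (E (Suc p))"
      using inv by (auto simp: alg_invariant_def interlaces_def)
    have row: "majorizing_row mu p (E p)"
    proof (rule majorizing_row_next[OF \<open>1 \<le> p\<close> _ int])
      show "majorizing_row mu (Suc p) (E (Suc p))"
        using inv by (simp add: alg_invariant_def)
      show "tail_bounds mu p (E (Suc p)) (E p) k" if "1 \<le> k" "k \<le> p" for k
        using inv that by (simp add: alg_invariant_def)
    qed
    have split: "{i..N} = insert i {Suc i..N}" if "i \<le> N" for i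
      using that by auto
    have "Suc p \<le> N"
      using inv by (simp add: alg_invariant_def)
    moreover have "\<forall>j\<in>{Suc p..N}. interlaces j (E (j - 1)) (E j)"
      using inv int split[OF \<open>Suc p \<le> N\<close>] by (simp add: alg_invariant_def)
    moreover have "\<forall>j\<in>{p..N}. majorizing_row mu j (E j)"
      using inv row split[of p] \<open>Suc p \<le> N\<close> by (simp add: alg_invariant_def)
    moreover have "tail_bounds mu (p-1) (E p) (E (p-1)) p"
      using start row n \<open>Suc p \<le> N\<close> by simp
    moreover have "\<forall>m\<in>{1..N}. E N m = lam m"
      using inv by (simp add: alg_invariant_def)
    ultimately show ?case
      using n unfolding alg_invariant_def by simp
  qed
qed

section \<open>Every array of eigensteps is produced by a run\<close>

lemma eigensteps_interlaces:
  assumes "inner_eigensteps N lam mu E" "1 \<le> n" "Suc n \<le> N"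
  shows "interlaces (Suc n) (E n) (E (Suc n))"
proof -
  have "\<forall>j\<in>{2..N}. interlaces j (E (j - 1)) (E j)"
    using assms by (simp add: inner_eigensteps_def)
  moreover have "Suc n \<in> {2..N}"
    using assms by auto
  ultimately have "interlaces (Suc n) (E (Suc n - 1)) (E (Suc n))"
    by (rule bspec)
  then show ?thesis by simp
qed

text \<open>
  Going from row \<open>n\<close> to row \<open>n + 1\<close> does not decrease the sum of the first \<open>l\<close> entries, and for
  \<open>n = l\<close> this sum is the prescribed sum of row \<open>l\<close>.
\<close>

lemma eigensteps_initial_sum_ge:
  assumes E: "inner_eigensteps N lam mu E" and "l \<le> n" "n \<le> N"
  shows "(\<Sum>m=1..l. mu m) \<le> (\<Sum>m=1..l. E n m)"
  using assms(2,3)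
proof (induction n rule: dec_induct)
  case base
  then show ?case
    using E by (cases "l = 0") (auto simp: inner_eigensteps_def)
next
  case (step n)
  have "(\<Sum>m=1..l. E n m) \<le> (\<Sum>m=1..l. E (Suc n) m)"
  proof (rule sum_mono)
    fix m assume m: "m \<in> {1..l}"
    then have "interlaces (Suc n) (E n) (E (Suc n))"
      using eigensteps_interlaces[OF E] step by simp
    then show "E n m \<le> E (Suc n) m"
      using m step by (auto simp: interlaces_def)
  qed
  then show ?case using step by simp
qed

lemma eigensteps_tail_bounds:
  assumes E: "inner_eigensteps N lam mu E" and "Suc p \<le> N" and k: "1 \<le> k" "k \<le> p"
  shows "tail_bounds mu p (E (Suc p)) (E p) k"
proof -
  let ?b = "E (Suc p)" and ?a = "E p"
  have "interlaces (Suc p) ?a ?b"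
    using eigensteps_interlaces[OF E] assms by simp
  then have int: "?b (Suc m) \<le> ?a m" "?a m \<le> ?b m" if "1 \<le> m" "m \<le> p" for m
    using that by (auto simp: interlaces_def)
  have a_total: "(\<Sum>m=1..p. ?a m) = (\<Sum>m=1..p. mu m)"
    using E assms by (auto simp: inner_eigensteps_def)
  have b_total: "(\<Sum>m=1..Suc p. ?b m) = (\<Sum>m=1..Suc p. mu m)"
    using E \<open>Suc p \<le> N\<close> unfolding inner_eigensteps_def
    by (simp del: sum.cl_ivl_Suc)
  have split: "sum f {1..n} = sum f {1..l-1} + sum f {l..n}"
    if "1 \<le> l" "l \<le> n" for l n and f :: "nat \<Rightarrow> real"
    using sum_split_interval[of 1 "l-1" n f] that by simp
  have "(\<Sum>m=1..k-1. ?a m) \<le> (\<Sum>m=1..k-1. ?b m)"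
    by (rule sum_mono) (use int k in auto)
  then have "(\<Sum>m=k..Suc p. ?b m) \<le> mu (Suc p) + (\<Sum>m=k..p. ?a m)"
    using a_total b_total split[of k p ?a] split[of k "Suc p" ?b] k by simp
  moreover have "(\<Sum>m=Suc l..k. ?b m) + (\<Sum>m=k..p. ?a m) \<le> (\<Sum>m=l..p. mu m)"
    if l: "1 \<le> l" "l \<le> k" for l
  proof -
    have "(\<Sum>m=Suc l..k. ?b m) = (\<Sum>m=l..k-1. ?b (Suc m))"
      using sum.shift_bounds_cl_Suc_ivl[of ?b l "k-1"] k by simp
    also have "\<dots> \<le> (\<Sum>m=l..k-1. ?a m)"
      by (rule sum_mono) (use int k l in auto)
    finally have "(\<Sum>m=Suc l..k. ?b m) + (\<Sum>m=k..p. ?a m) \<le> (\<Sum>m=l..p. ?a m)"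
      using sum_split_interval[of l "k-1" p ?a] k l by simp
    moreover have "(\<Sum>m=1..l-1. mu m) \<le> (\<Sum>m=1..l-1. ?a m)"
      by (rule eigensteps_initial_sum_ge[OF E]) (use assms l in auto)
    ultimately show ?thesis
      using a_total split[of l p ?a] split[of l p mu] k l by simp
  qed
  ultimately show ?thesis
    by (simp add: tail_bounds_def)
qed

lemma eigensteps_alg_state_row:
  assumes E: "inner_eigensteps N lam mu E" and "Suc p \<le> N"
    and st: "alg_state N lam mu (Suc p) (Suc p) E" and k: "1 \<le> k" "k \<le> Suc p"
  shows "alg_state N lam mu (Suc p) k E"
  using k(2,1)
proof (induction k rule: inc_induct)
  case base
  show ?case by (rule st)
next
  case (step k)
  have "interlaces (Suc p) (E p) (E (Suc p))"
    using eigensteps_interlaces[OF E] assms step by simp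
  then have "E p k \<in> {lower_end mu E (Suc p) k..upper_end mu E (Suc p) k}"
    using step assms eigensteps_tail_bounds[OF E, of p k]
    by (subst mem_pick_interval_iff) (auto simp: interlaces_def)
  \<comment> \<open>Picking the value that \<open>E\<close> already has does not change \<open>E\<close>.\<close>
  then have "alg_state N lam mu (Suc p) k (E(Suc p - 1 := (E (Suc p - 1))(k := E p k)))"
    using step by (intro alg_state.pick) auto
  then show ?case by simp
qed

lemma eigensteps_alg_state:
  assumes E: "inner_eigensteps N lam mu E" and n: "1 \<le> n" "n \<le> N"
  shows "alg_state N lam mu n n E"
  using n(2,1)
proof (induction n rule: inc_induct)
  case base
  show ?case
    using E by (intro alg_state.init) (auto simp: inner_eigensteps_def)
next
  case (step n)
  then have "alg_state N lam mu (Suc n) 1 E"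
    by - (rule eigensteps_alg_state_row[OF E], auto)
  then show ?case
    using alg_state.next_row[of N lam mu "Suc n" E] step by simp
qed

section \<open>The algorithm constructs exactly the inner eigensteps\<close>

theorem corollary4p2:
  fixes N :: nat and lam mu :: "nat \<Rightarrow> real"
  assumes "1 \<le> N"
    and "\<forall>n\<in>{1..N}. 0 \<le> lam n" and "antimono_on {1..N} lam"
    and "\<forall>n\<in>{1..N}. 0 \<le> mu n" and "antimono_on {1..N} mu"
    and "majorizes N lam mu"
  shows "algorithm_never_stuck N lam mu \<and>
    (\<forall>E. inner_eigensteps N lam mu E \<longrightarrow> constructed_by_algorithm N lam mu E) \<and>
    (\<forall>E. constructed_by_algorithm N lam mu E \<longrightarrow> inner_eigensteps N lam mu E)"
proof (intro conjI allI impI)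
  note invariant = alg_state_invariant[OF assms(1,3,5,6)]
  show "algorithm_never_stuck N lam mu"
    unfolding algorithm_never_stuck_def
  proof (intro allI impI)
    fix n k E
    assume "2 \<le> n" "1 \<le> k" and st: "alg_state N lam mu n (k + 1) E"
    then obtain p where n: "n = Suc p" by (cases n) auto
    have inv: "alg_invariant N lam mu (Suc p) (Suc k) E"
      using invariant[OF st] n by simp
    have "lower_end mu E (Suc p) k \<le> upper_end mu E (Suc p) k"
      using inv \<open>1 \<le> k\<close> by (intro lower_end_le_upper_end) (auto simp: alg_invariant_def)
    then show "{lower_end mu E n k..upper_end mu E n k} \<noteq> {}"
      using n by simp
  qed
next
  fix E
  assume "inner_eigensteps N lam mu E"
  then show "constructed_by_algorithm N lam mu E"
    using eigensteps_alg_state[of N lam mu E 1] assms(1)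
    by (simp add: constructed_by_algorithm_def)
next
  fix E
  assume "constructed_by_algorithm N lam mu E"
  then have "alg_invariant N lam mu 1 1 E"
    using alg_state_invariant[OF assms(1,3,5,6)] by (simp add: constructed_by_algorithm_def)
  then show "inner_eigensteps N lam mu E"
    by (auto simp: alg_invariant_def inner_eigensteps_def majorizing_row_def numeral_2_eq_2)
qed

end
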